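(* For all positive integers $m,n$, the complete bipartite graph $K_{m,n}$ satisfies $$E_{\mathrm{ISI}}(K_{m,n})=\frac{2(mn)^{3/2}}{m+n}.$$
   Context: For a simple graph $G$ with vertices $v_1,\dots,v_N$, let $d_i$ be the degree of $v_i$. The ISI matrix $S(G)=[s_{ij}]_{N\times N}$ has $s_{ij}=\frac{d_id_j}{d_i+d_j}$ if $v_i$ and $v_j$ are adjacent and $s_{ij}=0$ otherwise. The ISI energy is $E_{\mathrm{ISI}}(G)=\sum_{i=1}^N|\tau_i|$, where $\tau_1,\dots,\tau_N$ are the eigenvalues of $S(G)$ counted with multiplicity. *)

theory Defs
  imports
    "Graph_Theory.Kuratowski"
    "Jordan_Normal_Form.Char_Poly"
    "HOL-Computational_Algebra.Fundamental_Theorem_Algebra"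
begin

text \<open>
  Simple graphs are the finite symmetric loop-free digraphs without parallel arcs
  (locale \<^locale>\<open>graph\<close>): an edge between \<open>u\<close> and \<open>v\<close> is the pair of arcs from \<open>u\<close> to \<open>v\<close> and
  from \<open>v\<close> to \<open>u\<close>. Hence the number of edges at \<open>v\<close> is the number of arcs leaving \<open>v\<close>.
\<close>

abbreviation degree_of :: "('a, 'b) pre_digraph \<Rightarrow> 'a \<Rightarrow> nat" where
  "degree_of G v \<equiv> out_degree G v"

text \<open>The list \<open>vs\<close> is the numbering \<open>v\<^sub>1, \<dots>, v\<^sub>N\<close> of the vertices, shifted to start at \<open>0\<close>.\<close>

definition vertex_enum :: "('a, 'b) pre_digraph \<Rightarrow> 'a list \<Rightarrow> bool" where
  "vertex_enum G vs \<longleftrightarrow> distinct vs \<and> set vs = verts G"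

definition ISI_matrix :: "('a, 'b) pre_digraph \<Rightarrow> 'a list \<Rightarrow> real mat" where
  "ISI_matrix G vs = mat (length vs) (length vs) (\<lambda>(i, j).
     if vs ! i \<rightarrow>\<^bsub>G\<^esub> vs ! j
     then real (degree_of G (vs ! i)) * real (degree_of G (vs ! j)) /
          (real (degree_of G (vs ! i)) + real (degree_of G (vs ! j)))
     else 0)"

text \<open>
  The roots are taken over the complex numbers, so that there are as many eigenvalues as rows,
  without appeal to the spectral theorem for symmetric matrices.
\<close>

definition eigenvalue_mset :: "real mat \<Rightarrow> complex multiset" where
  "eigenvalue_mset A = proots (char_poly (map_mat complex_of_real A))"

definition ISI_energy :: "('a, 'b) pre_digraph \<Rightarrow> 'a list \<Rightarrow> real" where
  "ISI_energy G vs = (\<Sum>\<tau>\<in>#eigenvalue_mset (ISI_matrix G vs). cmod \<tau>)"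

lemma size_eigenvalue_mset:
  assumes "A \<in> carrier_mat n n"
  shows "size (eigenvalue_mset A) = n"
  using assms degree_monic_char_poly[of "map_mat complex_of_real A" n]
  by (simp add: eigenvalue_mset_def size_proots_complex)

lemma eigenvalue_mset_iff:
  assumes "A \<in> carrier_mat n n"
  shows "\<tau> \<in># eigenvalue_mset A \<longleftrightarrow> eigenvalue (map_mat complex_of_real A) \<tau>"
proof -
  have A: "map_mat complex_of_real A \<in> carrier_mat n n"
    using assms by simp
  then have "char_poly (map_mat complex_of_real A) \<noteq> 0"
    using degree_monic_char_poly[OF A] by auto
  then show ?thesis
    by (simp add: eigenvalue_mset_def eigenvalue_root_char_poly[OF A])
qed

end

theory Submission
  imports Defs "Jordan_Normal_Form.Schur_Decomposition"
begin

text \<open>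
  Every nonzero eigenvalue \<open>\<tau>\<close> of \<open>S(K\<^bsub>m,n\<^esub>)\<close> satisfies \<open>\<tau>\<^sup>2 = \<mu>\<^sup>2\<close> with \<open>\<mu> = (mn)\<^bsup>3/2\<^esup> / (m + n)\<close>, as one
  sees by summing the entries of an eigenvector over each side. The multiplicities need not be
  determined: \<open>\<mu> \<bar>\<tau>\<bar> = \<tau>\<^sup>2\<close> for every eigenvalue, so \<open>\<mu>\<close> times the energy is the sum of the squared
  eigenvalues, i.e. the trace of \<open>S\<^sup>2\<close>, which equals \<open>2 \<mu>\<^sup>2\<close>.
\<close>

section \<open>Traces and sums of squared eigenvalues\<close>

definition mat_trace :: "'a :: comm_monoid_add mat \<Rightarrow> 'a" where
  "mat_trace A = (\<Sum>i<dim_row A. A $$ (i, i))"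

lemma mat_trace_mult:
  assumes "A \<in> carrier_mat n m" "B \<in> carrier_mat m n"
  shows "mat_trace (A * B) = (\<Sum>i<n. \<Sum>j<m. A $$ (i, j) * B $$ (j, i))"
  using assms by (auto simp: mat_trace_def scalar_prod_def lessThan_atLeast0 intro!: sum.cong)

lemma mat_trace_commute:
  fixes A B :: "'a :: comm_semiring_0 mat"
  assumes "A \<in> carrier_mat n m" "B \<in> carrier_mat m n"
  shows "mat_trace (A * B) = mat_trace (B * A)"
  unfolding mat_trace_mult[OF assms] mat_trace_mult[OF assms(2,1)]
  by (subst sum.swap) (simp add: mult.commute)

lemma mat_trace_similar:
  fixes A B :: "'a :: comm_ring_1 mat"
  assumes "similar_mat A B"
  shows "mat_trace A = mat_trace B"
proof -
  obtain n P Q where carr: "{A, B, P, Q} \<subseteq> carrier_mat n n"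
    and QP: "Q * P = 1\<^sub>m n" and A: "A = P * B * Q"
    using similar_matD[OF assms] by blast
  then have B: "B \<in> carrier_mat n n" and P: "P \<in> carrier_mat n n" and Q: "Q \<in> carrier_mat n n"
    by auto
  have "mat_trace A = mat_trace (Q * (P * B))"
    unfolding A using B P Q by (intro mat_trace_commute) auto
  also have "Q * (P * B) = B"
    using assoc_mult_mat[OF Q P B] B by (simp add: QP)
  finally show ?thesis .
qed

text \<open>For i \<noteq> j one of the entries (i, j) and (j, i) lies strictly below the diagonal,
  so every off-diagonal product in the trace vanishes and only the squared diagonal entries
  survive.\<close>

lemma mat_trace_square_upper_triangular:
  fixes B :: "'a :: comm_semiring_1 mat"
  assumes "B \<in> carrier_mat n n" "upper_triangular B"
  shows "mat_trace (B * B) = (\<Sum>e\<leftarrow>diag_mat B. e\<^sup>2)"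
proof -
  have "(\<Sum>j<n. B $$ (i, j) * B $$ (j, i)) = (B $$ (i, i))\<^sup>2" if i: "i < n" for i
  proof -
    have "B $$ (i, j) * B $$ (j, i) = 0" if "j < n" "j \<noteq> i" for j
      using assms i that upper_triangularD[OF assms(2), of j i] upper_triangularD[OF assms(2), of i j]
      by (cases "j < i") auto
    then have "(\<Sum>j<n. B $$ (i, j) * B $$ (j, i)) = (\<Sum>j\<in>{i}. B $$ (i, j) * B $$ (j, i))"
      using i by (intro sum.mono_neutral_right) auto
    then show ?thesis by (simp add: power2_eq_square)
  qed
  then show ?thesis
    unfolding mat_trace_mult[OF assms(1) assms(1)] using assms(1)
    by (simp add: diag_mat_def comp_def interv_sum_list_conv_sum_set_nat lessThan_atLeast0)
qed

text \<open>Schur decomposition makes A similar to an upper triangular B that carries the roots of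
  the characteristic polynomial on its diagonal. Then A * A is similar to B * B, and similar
  matrices have equal traces.\<close>

lemma sum_mset_square_proots_char_poly:
  fixes A :: "complex mat"
  assumes A: "A \<in> carrier_mat n n"
  shows "(\<Sum>\<tau>\<in>#proots (char_poly A). \<tau>\<^sup>2) = mat_trace (A * A)"
proof -
  obtain es where es: "char_poly A = (\<Prod>e\<leftarrow>es. [:- e, 1:])"
    using char_poly_factorized[OF A] by blast
  obtain B P Q where "schur_decomposition A es = (B, P, Q)"
    by (cases "schur_decomposition A es")
  from schur_decomposition[OF A es this]
  have wit: "similar_mat_wit A B P Q" and ut: "upper_triangular B" and diag: "diag_mat B = es"
    by auto
  have B: "B \<in> carrier_mat n n"
    using similar_mat_witD2[OF A wit] by simp
  have "similar_mat (A ^\<^sub>m 2) (B ^\<^sub>m 2)"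
    using similar_mat_wit_pow[OF wit] unfolding similar_mat_def by blast
  moreover have "A ^\<^sub>m 2 = A * A" "B ^\<^sub>m 2 = B * B"
    using A B by (auto simp: numeral_2_eq_2)
  ultimately have "mat_trace (A * A) = mat_trace (B * B)"
    using mat_trace_similar by metis
  also have "\<dots> = (\<Sum>e\<leftarrow>es. e\<^sup>2)"
    using mat_trace_square_upper_triangular[OF B ut] diag by simp
  finally have tr: "mat_trace (A * A) = (\<Sum>e\<leftarrow>es. e\<^sup>2)" .
  \<comment> \<open>The list is quantified afresh, shadowing the fixed \<open>es\<close>, so that
    the induction does not involve the facts about that \<open>es\<close>. Equality of multisets is
    what accounts for the multiplicities.\<close>
  have "proots (\<Prod>e\<leftarrow>es. [:- e, 1:]) = mset es" for es :: "complex list"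
  proof (induction es)
    case (Cons e es)
    have "(\<Prod>e\<leftarrow>es. [:- e, 1:]) \<noteq> 0" by (auto simp: prod_list_zero_iff)
    then show ?case using Cons by (simp add: proots_mult del: mult_pCons_left)
  qed simp
  then show ?thesis
    unfolding es tr by (simp flip: sum_mset_sum_list)
qed

section \<open>Matrices with one constant value between two sides and zeros within each side\<close>

definition bipartite_block_mat :: "nat \<Rightarrow> nat set \<Rightarrow> nat set \<Rightarrow> 'a \<Rightarrow> 'a :: zero mat" where
  "bipartite_block_mat N I J c =
     mat N N (\<lambda>(i, j). if (i, j) \<in> I \<times> J \<union> J \<times> I then c else 0)"

lemma bipartite_block_mat_carrier [simp]: "bipartite_block_mat N I J c \<in> carrier_mat N N"
  by (simp add: bipartite_block_mat_def)

text \<open>Swapping the sides lets a fact about rows in I serve for rows in J.\<close>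

lemma bipartite_block_mat_commute:
  "bipartite_block_mat N I J c = bipartite_block_mat N J I c"
  unfolding bipartite_block_mat_def by (intro cong_mat) auto

context
  fixes N :: nat and I J :: "nat set"
  assumes part: "I \<union> J = {..<N}" "I \<inter> J = {}"
begin

lemma finite_parts: "finite I" "finite J"
  using part(1) by (metis finite_Un finite_lessThan)+

lemma bipartite_block_mat_mult_vec:
  fixes c :: "'a :: comm_semiring_1"
  assumes v: "v \<in> carrier_vec N" and i: "i \<in> I"
  shows "(bipartite_block_mat N I J c *\<^sub>v v) $ i = c * (\<Sum>j\<in>J. v $ j)"
proof -
  have iN: "i < N" and iJ: "i \<notin> J" and J: "J \<subseteq> {..<N}" using i part by auto
  have "(bipartite_block_mat N I J c *\<^sub>v v) $ i = (\<Sum>j<N. if j \<in> J then c * v $ j else 0)"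
    using v i iN iJ
    by (auto simp: bipartite_block_mat_def scalar_prod_def lessThan_atLeast0 intro!: sum.cong)
  also have "\<dots> = (\<Sum>j\<in>{..<N} \<inter> J. c * v $ j)"
    by (simp add: sum.inter_restrict)
  also have "{..<N} \<inter> J = J" using J by auto
  finally show ?thesis by (simp add: sum_distrib_left)
qed

text \<open>The trace is a sum over ordered pairs (i, j) in which a pair joining the two sides
  contributes the square of c and any other pair contributes 0. There are card I * card J joining
  pairs in each direction.\<close>

lemma mat_trace_bipartite_block_mat_square:
  fixes c :: "'a :: comm_semiring_1"
  defines "A \<equiv> bipartite_block_mat N I J c"
  shows "mat_trace (A * A) = 2 * of_nat (card I * card J) * c\<^sup>2"
proof -
  have A: "A \<in> carrier_mat N N" by (simp add: A_def)
  have sub: "I \<times> J \<union> J \<times> I \<subseteq> {..<N} \<times> {..<N}" using part by auto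
  have "mat_trace (A * A) = (\<Sum>(i, j)\<in>{..<N} \<times> {..<N}. A $$ (i, j) * A $$ (j, i))"
    unfolding mat_trace_mult[OF A A] by (simp add: sum.cartesian_product)
  also have "\<dots> = (\<Sum>p\<in>{..<N} \<times> {..<N}. if p \<in> I \<times> J \<union> J \<times> I then c\<^sup>2 else 0)"
    by (rule sum.cong) (auto simp: A_def bipartite_block_mat_def power2_eq_square split: if_splits)
  also have "\<dots> = (\<Sum>p\<in>{..<N} \<times> {..<N} \<inter> (I \<times> J \<union> J \<times> I). c\<^sup>2)"
    by (rule sum.inter_restrict[symmetric]) auto
  also have "{..<N} \<times> {..<N} \<inter> (I \<times> J \<union> J \<times> I) = I \<times> J \<union> J \<times> I"
    using sub by auto
  also have "(\<Sum>p\<in>I \<times> J \<union> J \<times> I. c\<^sup>2) = of_nat (card (I \<times> J \<union> J \<times> I)) * c\<^sup>2"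
    by simp
  also have "card (I \<times> J \<union> J \<times> I) = 2 * (card I * card J)"
    using part(2) finite_parts by (subst card_Un_disjoint) (auto simp: card_cartesian_product)
  finally show ?thesis by simp
qed

end

text \<open>Let x and y be the sums of an eigenvector over I and J. The eigenvalue equation
  collapses to \<tau> x = card I * c * y and \<tau> y = card J * c * x; applying both in turn
  multiplies x, and likewise y, by the claimed value.\<close>

lemma eigenvalue_bipartite_block_mat:
  fixes c :: "'a :: field"
  assumes part: "I \<union> J = {..<N}" "I \<inter> J = {}"
    and ev: "eigenvalue (bipartite_block_mat N I J c) \<tau>" and "\<tau> \<noteq> 0"
  shows "\<tau>\<^sup>2 = of_nat (card I * card J) * c\<^sup>2"
proof -
  let ?A = "bipartite_block_mat N I J c"
  obtain v where v: "v \<in> carrier_vec N" "v \<noteq> 0\<^sub>v N" and Av: "?A *\<^sub>v v = \<tau> \<cdot>\<^sub>v v"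
    using ev unfolding eigenvalue_def eigenvector_def
    by (auto simp: bipartite_block_mat_def)
  define x y where "x = (\<Sum>i\<in>I. v $ i)" and "y = (\<Sum>j\<in>J. v $ j)"
  have vI: "\<tau> * v $ i = c * y" if "i \<in> I" for i
  proof -
    have "i < N" using that part by auto
    then show ?thesis
      using bipartite_block_mat_mult_vec[OF part v(1) that, of c] v(1) by (simp add: Av y_def)
  qed
  have part': "J \<union> I = {..<N}" "J \<inter> I = {}" using part by auto
  have vJ: "\<tau> * v $ j = c * x" if "j \<in> J" for j
  proof -
    have "j < N" using that part by auto
    then show ?thesis
      using bipartite_block_mat_mult_vec[OF part' v(1) that, of c] v(1)
      by (simp add: Av x_def bipartite_block_mat_commute[of N J I])
  qed
  have x: "\<tau> * x = of_nat (card I) * (c * y)"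
    unfolding x_def sum_distrib_left using vI by simp
  have y: "\<tau> * y = of_nat (card J) * (c * x)"
    unfolding y_def sum_distrib_left using vJ by simp
  have "\<tau>\<^sup>2 * x = of_nat (card I) * (c * (\<tau> * y))"
    using x by (simp add: power2_eq_square algebra_simps)
  then have x2: "\<tau>\<^sup>2 * x = of_nat (card I * card J) * c\<^sup>2 * x"
    unfolding y by (simp add: power2_eq_square algebra_simps)
  have "\<tau>\<^sup>2 * y = of_nat (card J) * (c * (\<tau> * x))"
    using y by (simp add: power2_eq_square algebra_simps)
  then have y2: "\<tau>\<^sup>2 * y = of_nat (card I * card J) * c\<^sup>2 * y"
    unfolding x by (simp add: power2_eq_square algebra_simps)
  \<comment> \<open>Since \<tau> is nonzero, \<open>vI\<close> and \<open>vJ\<close> recover every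
    entry of v from x and y, so both sums vanishing would force v = 0. Hence x or y can be cancelled
    in \<open>x2\<close> or \<open>y2\<close>.\<close>
  have "x \<noteq> 0 \<or> y \<noteq> 0"
  proof (rule ccontr)
    assume "\<not> (x \<noteq> 0 \<or> y \<noteq> 0)"
    then have "v $ i = 0" if "i < N" for i
      using that vI[of i] vJ[of i] \<open>\<tau> \<noteq> 0\<close> part(1) by (cases "i \<in> I") auto
    then show False using v by (auto intro: eq_vecI)
  qed
  then show ?thesis using x2 y2 by auto
qed

lemma sum_mset_norm_proots_char_poly_bipartite_block_mat:
  fixes c :: real
  assumes part: "I \<union> J = {..<N}" "I \<inter> J = {}" and "I \<noteq> {}" "J \<noteq> {}" and c: "c > 0"
  shows "(\<Sum>\<tau>\<in>#proots (char_poly (bipartite_block_mat N I J (complex_of_real c))). cmod \<tau>) =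
         2 * (c * sqrt (card I * card J))"
proof -
  let ?A = "bipartite_block_mat N I J (complex_of_real c)"
  let ?P = "proots (char_poly ?A)"
  define \<mu> where "\<mu> = c * sqrt (card I * card J)"
  have A: "?A \<in> carrier_mat N N" by simp
  have nz: "char_poly ?A \<noteq> 0" using degree_monic_char_poly[OF A] by auto
  have "card I > 0" "card J > 0"
    using assms finite_parts[OF part] by (simp_all add: card_gt_0_iff)
  \<comment> \<open>Positivity is used twice: to pass from equal squares to cmod \<tau> = \<mu>, and
    to cancel \<mu> at the end.\<close>
  then have \<mu>: "\<mu> > 0" and \<mu>2: "\<mu>\<^sup>2 = card I * card J * c\<^sup>2"
    using c by (simp_all add: \<mu>_def power_mult_distrib)
  \<comment> \<open>Both sides vanish at \<tau> = 0, so the identity is uniform over all eigenvalues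
    and can be summed without knowing the rank.\<close>
  have sq: "complex_of_real (\<mu> * cmod \<tau>) = \<tau>\<^sup>2" if "\<tau> \<in># ?P" for \<tau>
  proof (cases "\<tau> = 0")
    case False
    have "eigenvalue ?A \<tau>"
      using that nz by (simp add: eigenvalue_root_char_poly[OF A])
    then have "\<tau>\<^sup>2 = of_nat (card I * card J) * (complex_of_real c)\<^sup>2"
      using eigenvalue_bipartite_block_mat[OF part] False by blast
    then have \<tau>2: "\<tau>\<^sup>2 = complex_of_real (\<mu>\<^sup>2)" by (simp add: \<mu>2)
    then have "(cmod \<tau>)\<^sup>2 = \<mu>\<^sup>2"
      by (metis norm_power norm_of_real abs_of_nonneg zero_le_power2)
    then have "cmod \<tau> = \<mu>" using \<mu> by simp
    then show ?thesis using \<tau>2 by (simp add: power2_eq_square)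
  qed simp
  have "complex_of_real (\<mu> * (\<Sum>\<tau>\<in>#?P. cmod \<tau>)) = (\<Sum>\<tau>\<in>#?P. complex_of_real (\<mu> * cmod \<tau>))"
  proof -
    have "complex_of_real (\<mu> * (\<Sum>\<tau>\<in>#M. cmod \<tau>)) = (\<Sum>\<tau>\<in>#M. complex_of_real (\<mu> * cmod \<tau>))" for M
      by (induction M) (simp_all add: algebra_simps)
    then show ?thesis .
  qed
  also have "\<dots> = (\<Sum>\<tau>\<in>#?P. \<tau>\<^sup>2)"
    using sq by (intro arg_cong[where f = sum_mset] image_mset_cong) auto
  also have "\<dots> = mat_trace (?A * ?A)"
    by (rule sum_mset_square_proots_char_poly[OF A])
  also have "\<dots> = complex_of_real (2 * \<mu>\<^sup>2)"
    by (simp add: mat_trace_bipartite_block_mat_square[OF part] \<mu>2)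
  finally have "\<mu> * (\<Sum>\<tau>\<in>#?P. cmod \<tau>) = \<mu> * (2 * \<mu>)"
    unfolding of_real_eq_iff by (simp only: power2_eq_square mult.left_commute)
  then have "(\<Sum>\<tau>\<in>#?P. cmod \<tau>) = 2 * \<mu>"
    unfolding mult_cancel_left using \<mu> by simp
  then show ?thesis unfolding \<mu>_def by simp
qed

section \<open>Degrees, vertex numberings and the ISI energy of the complete bipartite graph\<close>

lemma (in nomulti_digraph) out_degree_eq_card_successors:
  "out_degree G u = card {v. u \<rightarrow>\<^bsub>G\<^esub> v}"
proof -
  \<comment> \<open>Without parallel arcs, an arc leaving u is determined by its head, so counting
    arcs amounts to counting neighbours.\<close>
  have "inj_on (head G) (out_arcs G u)"
    by (rule inj_onI) (auto intro!: no_multi_arcs simp: arc_to_ends_def)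
  moreover have "head G ` out_arcs G u = {v. u \<rightarrow>\<^bsub>G\<^esub> v}"
    by (force simp: arcs_ends_def arc_to_ends_def)
  ultimately show ?thesis
    unfolding out_degree_def by (metis card_image)
qed

text \<open>A duplicate-free list is a bijection from positions to elements. This carries the sizes
  of the two vertex classes over to their index sets.\<close>

lemma card_nth_preimage:
  assumes "distinct xs" "A \<subseteq> set xs"
  shows "card {i. i < length xs \<and> xs ! i \<in> A} = card A"
proof -
  have "inj_on ((!) xs) {i. i < length xs \<and> xs ! i \<in> A}"
    using assms(1) by (auto simp: inj_on_def nth_eq_iff_index_eq)
  moreover have "(!) xs ` {i. i < length xs \<and> xs ! i \<in> A} = A"
    using assms(2) by (force simp: in_set_conv_nth)
  ultimately show ?thesis by (metis card_image)
qed

theorem theorem3p2: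
  fixes G :: "('a, 'b) pre_digraph" and m n :: nat and vs :: "'a list"
  assumes "m > 0" and "n > 0"
    and "K\<^bsub>m,n\<^esub> G"
    and "vertex_enum G vs"
  shows "ISI_energy G vs = 2 * (real m * real n) powr (3 / 2) / (real m + real n)"
proof -
  interpret graph G using assms(3) by (simp add: complete_bipartite_digraph_def)
  obtain U V where verts: "verts G = U \<union> V" and disj: "U \<inter> V = {}"
    and cU: "card U = m" and cV: "card V = n" and arcs: "arcs_ends G = U \<times> V \<union> V \<times> U"
    using assms(3) unfolding complete_bipartite_digraph_def by blast
  have vs: "distinct vs" "set vs = U \<union> V"
    using assms(4) by (simp_all add: vertex_enum_def verts)
  have dU: "out_degree G u = n" if "u \<in> U" for u
  proof -
    have "{v. u \<rightarrow>\<^bsub>G\<^esub> v} = V" using that disj arcs by auto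
    then show ?thesis by (simp add: out_degree_eq_card_successors cV)
  qed
  have dV: "out_degree G v = m" if "v \<in> V" for v
  proof -
    have "{u. v \<rightarrow>\<^bsub>G\<^esub> u} = U" using that disj arcs by auto
    then show ?thesis by (simp add: out_degree_eq_card_successors cU)
  qed
  \<comment> \<open>The numbering is arbitrary and may interleave the two classes, so the sides are
    index sets rather than contiguous blocks.\<close>
  define I J where "I = {i. i < length vs \<and> vs ! i \<in> U}"
    and "J = {i. i < length vs \<and> vs ! i \<in> V}"
  \<comment> \<open>Every edge joins a vertex of degree n to one of degree m, so all nonzero entries
    of the ISI matrix equal this c.\<close>
  define c where "c = real m * real n / (real m + real n)"
  have cI: "card I = m" and cJ: "card J = n"
    using card_nth_preimage[OF vs(1)] vs(2) by (simp_all add: I_def J_def cU cV)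
  have part: "I \<union> J = {..<length vs}" "I \<inter> J = {}"
    using vs(2) disj nth_mem[of _ vs] by (auto simp: I_def J_def)
  have ne: "I \<noteq> {}" "J \<noteq> {}" using assms(1,2) cI cJ by auto
  have c: "c > 0" using assms(1,2) by (simp add: c_def)
  have "map_mat complex_of_real (ISI_matrix G vs) =
      bipartite_block_mat (length vs) I J (complex_of_real c)"
    by (rule eq_matI)
      (auto simp: ISI_matrix_def bipartite_block_mat_def arcs I_def J_def c_def dU dV ac_simps)
  then have "ISI_energy G vs = 2 * (c * sqrt (m * n))"
    using sum_mset_norm_proots_char_poly_bipartite_block_mat[OF part ne c]
    by (simp add: ISI_energy_def eigenvalue_mset_def cI cJ)
  \<comment> \<open>This identity is not itself a link of the chain: it yields the next equation,
    which \<open>finally\<close> composes with the formula for the energy. Splitting 3/2 as 1 + 1/2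
    produces the square root.\<close>
  also have "(real m * real n) powr (3 / 2) = real m * real n * sqrt (m * n)"
  proof -
    have "(real m * real n) powr (1 + 1 / 2) = real m * real n * sqrt (m * n)"
      unfolding powr_add using assms(1,2) by (simp add: powr_half_sqrt)
    then show ?thesis by simp
  qed
  then have "2 * (c * sqrt (m * n)) = 2 * (real m * real n) powr (3 / 2) / (real m + real n)"
    by (simp add: c_def)
  finally show ?thesis .
qed

end
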